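(* Let $A\in\mathbb{R}^{n\times n}$, $B\in\mathbb{R}^{n\times m}$, $C\in\mathbb{R}^{p\times n}$ and consider the system $x_{t+1}=Ax_t+Bu_t$, $y_t=Cx_t$. Assume that $(A,B)$ is controllable, that $(A,C)$ and $(A,Q_x^{1/2})$ are observable, where $Q_x=C^\top QC$, and that $N\ge \ell$, where $\ell$ is the observability index of the system. Then: (a) For every trajectory of the system, the state $x_t$ can be expressed in terms of the historical input-output trajectory $\xi_t:=[u_{t-N}^\top,\dots,u_{t-1}^\top,y_{t-N}^\top,\dots,y_{t-1}^\top]^\top$ as $$x_t=M\xi_t,\qquad M:=\big[\mathcal{R}_N(A,B)-A^N\mathcal{O}_N(A,C)^\dagger\mathcal{T}_N(A,B,C),\; A^N\mathcal{O}_N(A,C)^\dagger\big].$$ (b) The matrix $M\in\mathbb{R}^{n\times(m+p)N}$ has full row rank.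
   Context: Here $p\le n$, $C$ has full row rank, and $Q\in\mathbb{R}^{p\times p}$ is a symmetric positive semidefinite matrix. $(\cdot)^\dagger$ is the Moore-Penrose pseudo-inverse and $X^{1/2}$ is the unique symmetric positive semidefinite square root. The observability index $\ell$ is the smallest positive integer $N$ such that $\mathcal{O}_N(A,C)$ has rank $n$. Notation: $\mathcal{R}_N(A,B):=[A^{N-1}B,\dots,AB,B]$; $\mathcal{O}_N(A,C):=[C^\top,(CA)^\top,\dots,(CA^{N-1})^\top]^\top$; $\mathcal{T}_N(A,B,C)$ is the $pN\times mN$ block lower-triangular Toeplitz matrix with zero diagonal blocks whose $(i,j)$ block ($1\le i,j\le N$) is $CA^{i-j-1}B$ for $i>j$ and $\mathbf 0$ otherwise. *)

theory Defs
  imports "Jordan_Normal_Form.DL_Rank"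
begin

text \<open>All dimensions are natural numbers carried by the matrices; blocks, time steps and matrix
  entries are indexed from 0.\<close>

definition mat_rank :: "real mat \<Rightarrow> nat" where
  "mat_rank X = vec_space.rank (dim_row X) X"

definition full_row_rank :: "real mat \<Rightarrow> bool" where
  "full_row_rank X \<longleftrightarrow> mat_rank X = dim_row X"

definition pos_semidef :: "real mat \<Rightarrow> bool" where
  "pos_semidef X \<longleftrightarrow> square_mat X \<and> transpose_mat X = X \<and>
     (\<forall>v \<in> carrier_vec (dim_row X). 0 \<le> v \<bullet> (X *\<^sub>v v))"

definition psd_sqrt :: "real mat \<Rightarrow> real mat" where
  "psd_sqrt X = (THE S. S \<in> carrier_mat (dim_row X) (dim_row X) \<and> pos_semidef S \<and> S * S = X)"

text \<open>The four Penrose conditions.\<close>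

definition is_pseudo_inverse :: "real mat \<Rightarrow> real mat \<Rightarrow> bool" where
  "is_pseudo_inverse X P \<longleftrightarrow> P \<in> carrier_mat (dim_col X) (dim_row X) \<and>
     X * P * X = X \<and> P * X * P = P \<and>
     transpose_mat (X * P) = X * P \<and> transpose_mat (P * X) = P * X"

definition pseudo_inverse :: "real mat \<Rightarrow> real mat" where
  "pseudo_inverse X = (THE P. is_pseudo_inverse X P)"

definition append_cols :: "real mat \<Rightarrow> real mat \<Rightarrow> real mat" where
  "append_cols X Y = four_block_mat X Y (0\<^sub>m 0 (dim_col X)) (0\<^sub>m 0 (dim_col Y))"

text \<open>The reachability matrix \<open>[A^(N-1) B, ..., A B, B]\<close>: column block \<open>k < N\<close> is
  \<open>A^(N-1-k) B\<close>.\<close>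

definition reach_mat :: "nat \<Rightarrow> real mat \<Rightarrow> real mat \<Rightarrow> real mat" where
  "reach_mat N A B = mat (dim_row A) (dim_col B * N)
     (\<lambda>(i, j). (A ^\<^sub>m (N - 1 - j div dim_col B) * B) $$ (i, j mod dim_col B))"

text \<open>The observability matrix: row block \<open>k < N\<close> is \<open>C A^k\<close>.\<close>

definition obs_mat :: "nat \<Rightarrow> real mat \<Rightarrow> real mat \<Rightarrow> real mat" where
  "obs_mat N A C = mat (dim_row C * N) (dim_col A)
     (\<lambda>(i, j). (C * A ^\<^sub>m (i div dim_row C)) $$ (i mod dim_row C, j))"

text \<open>The block Toeplitz matrix: block \<open>(k, l)\<close> is \<open>C A^(k-l-1) B\<close> for \<open>k > l\<close> and zero otherwise.\<close>

definition toeplitz_mat :: "nat \<Rightarrow> real mat \<Rightarrow> real mat \<Rightarrow> real mat \<Rightarrow> real mat" where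
  "toeplitz_mat N A B C = mat (dim_row C * N) (dim_col B * N)
     (\<lambda>(i, j). let k = i div dim_row C; l = j div dim_col B in
        if l < k then (C * A ^\<^sub>m (k - l - 1) * B) $$ (i mod dim_row C, j mod dim_col B) else 0)"

definition controllable :: "real mat \<Rightarrow> real mat \<Rightarrow> bool" where
  "controllable A B \<longleftrightarrow> mat_rank (reach_mat (dim_row A) A B) = dim_row A"

definition observable :: "real mat \<Rightarrow> real mat \<Rightarrow> bool" where
  "observable A C \<longleftrightarrow> mat_rank (obs_mat (dim_row A) A C) = dim_row A"

definition obs_index :: "real mat \<Rightarrow> real mat \<Rightarrow> nat" where
  "obs_index A C = (LEAST N. 0 < N \<and> mat_rank (obs_mat N A C) = dim_row A)"

definition trajectory ::
  "real mat \<Rightarrow> real mat \<Rightarrow> real mat \<Rightarrow>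
   (nat \<Rightarrow> real vec) \<Rightarrow> (nat \<Rightarrow> real vec) \<Rightarrow> (nat \<Rightarrow> real vec) \<Rightarrow> bool" where
  "trajectory A B C u x y \<longleftrightarrow>
     (\<forall>t. u t \<in> carrier_vec (dim_col B) \<and> x t \<in> carrier_vec (dim_row A) \<and>
          x (Suc t) = A *\<^sub>v x t + B *\<^sub>v u t \<and> y t = C *\<^sub>v x t)"

text \<open>For \<open>w s\<close> of dimension \<open>d\<close> and \<open>N \<le> t\<close>, the window is the stacked vector
  \<open>[w (t-N); ...; w (t-1)]\<close> of dimension \<open>d N\<close>.\<close>

definition window :: "nat \<Rightarrow> nat \<Rightarrow> (nat \<Rightarrow> real vec) \<Rightarrow> nat \<Rightarrow> real vec" where
  "window d N w t = vec (d * N) (\<lambda>i. w (t - N + i div d) $ (i mod d))"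

definition io_history ::
  "nat \<Rightarrow> nat \<Rightarrow> nat \<Rightarrow> (nat \<Rightarrow> real vec) \<Rightarrow> (nat \<Rightarrow> real vec) \<Rightarrow> nat \<Rightarrow> real vec" where
  "io_history m p N u y t = window m N u t @\<^sub>v window p N y t"

definition state_map :: "nat \<Rightarrow> real mat \<Rightarrow> real mat \<Rightarrow> real mat \<Rightarrow> real mat" where
  "state_map N A B C = append_cols
     (reach_mat N A B - A ^\<^sub>m N * pseudo_inverse (obs_mat N A C) * toeplitz_mat N A B C)
     (A ^\<^sub>m N * pseudo_inverse (obs_mat N A C))"

end

theory Submission
  imports Defs
begin

text \<open>
  For \<open>N\<close> at least the observability index, \<open>O\<^sub>N\<close> is injective, so its pseudo-inverse is the left
  inverse \<open>P = (O\<^sub>N\<^sup>T O\<^sub>N)\<^sup>-\<^sup>1 O\<^sub>N\<^sup>T\<close>. The window equations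
  \<open>y = O\<^sub>N x\<^sub>t\<^sub>-\<^sub>N + T\<^sub>N u\<close> and \<open>x\<^sub>t = A\<^sup>N x\<^sub>t\<^sub>-\<^sub>N + R\<^sub>N u\<close> then give the formula for the state.
  For the rank, let \<open>v\<^sup>T M = 0\<close>. The second block gives \<open>v\<^sup>T A\<^sup>N P = 0\<close>, hence
  \<open>v\<^sup>T A\<^sup>N = v\<^sup>T A\<^sup>N P O\<^sub>N = 0\<close>, and the first block reduces to \<open>v\<^sup>T R\<^sub>N = 0\<close>. Thus \<open>v\<^sup>T A\<^sup>k B = 0\<close> for
  \<open>k < N\<close> and for \<open>k \<ge> N\<close> alike, so \<open>v = 0\<close> by controllability.
\<close>

subsection \<open>Full rank as injectivity\<close>

lemma real_scalar_prod_self_eq_0: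
  fixes v :: "real vec"
  assumes "v \<in> carrier_vec n" "v \<bullet> v = 0"
  shows "v = 0\<^sub>v n"
  using conjugate_square_eq_0_vec[OF assms(1)] assms(2) by (simp add: conjugate_vec_def)

text \<open>Pairing the hypothesis with \<open>v\<close> gives
  \<open>(X v) \<bullet> (X v) = 0\<close>, and over the reals only the zero vector has zero norm.
  This turns injectivity of \<open>X\<close> into invertibility of its Gram matrix.\<close>

lemma gram_mult_vec_eq_0:
  fixes X :: "real mat"
  assumes X: "X \<in> carrier_mat nr nc" and v: "v \<in> carrier_vec nc"
    and 0: "(transpose_mat X * X) *\<^sub>v v = 0\<^sub>v nc"
  shows "X *\<^sub>v v = 0\<^sub>v nr"
proof -
  have Xv: "X *\<^sub>v v \<in> carrier_vec nr" using X v by auto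
  have "(X *\<^sub>v v) \<bullet> (X *\<^sub>v v) = (transpose_mat X *\<^sub>v (X *\<^sub>v v)) \<bullet> v"
    using transpose_vec_mult_scalar[OF X v Xv] by simp
  also have "\<dots> = 0" using 0 X v by simp
  finally show ?thesis using real_scalar_prod_self_eq_0[OF Xv] by simp
qed

lemma injective_square_mat_inverse:
  fixes G :: "real mat"
  assumes G: "G \<in> carrier_mat n n"
    and inj: "\<And>v. v \<in> carrier_vec n \<Longrightarrow> G *\<^sub>v v = 0\<^sub>v n \<Longrightarrow> v = 0\<^sub>v n"
  obtains H where "H \<in> carrier_mat n n" "H * G = 1\<^sub>m n" "G * H = 1\<^sub>m n"
proof -
  have "det G \<noteq> 0" using det_0_iff_vec_prod_zero_field[OF G] inj by auto
  \<comment> \<open>The unit value only fills the extension field of the ring record; membership in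
    \<open>Units\<close> of that ring supplies the two-sided inverse.\<close>
  from det_non_zero_imp_unit[OF G this, of "()"] show ?thesis
    using that unfolding Units_def ring_mat_def by auto
qed

text \<open>The rank counts a maximal independent subset of the set of columns, and a set forgets
  repetitions. Rank \<open>nc\<close> forces that set to have \<open>nc\<close> elements, so the
  columns are distinct; then a nonzero kernel vector would be a linear dependence among
  them.\<close>

lemma full_col_rank_injective:
  assumes X: "X \<in> carrier_mat nr nc" and r: "mat_rank X = nc"
    and v: "v \<in> carrier_vec nc" and Xv: "X *\<^sub>v v = 0\<^sub>v nr"
  shows "v = 0\<^sub>v nc"
proof -
  interpret vec_space "TYPE(real)" nr .
  have r': "rank X = nc" using r X unfolding mat_rank_def by simp
  have "lin_indpt {}" by (simp add: lin_dep_def)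
  then obtain S where S: "maximal S (\<lambda>T. T \<subseteq> set (cols X) \<and> lin_indpt T)"
    using maximal_exists_superset[of "set (cols X)" "\<lambda>T. T \<subseteq> set (cols X) \<and> lin_indpt T" "{}"]
    by auto
  have "nc = card S" using rank_card_indpt[OF X S] r' by simp
  also have "\<dots> \<le> card (set (cols X))" using S by (simp add: card_mono maximal_def)
  finally have "card (set (cols X)) = length (cols X)"
    using X card_length[of "cols X"] by auto
  then have d: "distinct (cols X)" by (rule card_distinct)
  show ?thesis
    using lin_depI[OF X v _ Xv d] full_rank_lin_indpt[OF X r' d] by blast
qed

text \<open>A maximal independent set of columns has \<open>nr\<close> elements and so is a basis.
  Hence \<open>v = X w\<close> for some \<open>w\<close>, and moving \<open>X\<close> across the
  scalar product gives \<open>v \<bullet> v = (X^T v) \<bullet> w = 0\<close>.\<close>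

lemma full_row_rank_transpose_injective:
  assumes X: "X \<in> carrier_mat nr nc" and r: "mat_rank X = nr"
    and v: "v \<in> carrier_vec nr" and Xv: "transpose_mat X *\<^sub>v v = 0\<^sub>v nc"
  shows "v = 0\<^sub>v nr"
proof -
  interpret vec_space "TYPE(real)" nr .
  have r': "rank X = nr" using r X unfolding mat_rank_def by simp
  have "lin_indpt {}" by (simp add: lin_dep_def)
  then obtain S where S: "maximal S (\<lambda>T. T \<subseteq> set (cols X) \<and> lin_indpt T)" "finite S"
    using maximal_exists_superset[of "set (cols X)" "\<lambda>T. T \<subseteq> set (cols X) \<and> lin_indpt T" "{}"]
    by auto
  have cS: "card S = nr" using rank_card_indpt[OF X S(1)] r' by simp
  have Sc: "S \<subseteq> set (cols X)" and Sl: "lin_indpt S" using S(1) by (auto simp: maximal_def)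
  have "set (cols X) \<subseteq> carrier_vec nr" using X cols_dim by blast
  then have "basis S"
    using dim_li_is_basis[OF fin_dim S(2)] Sc Sl cS dim_is_n by auto
  then have "span S = carrier_vec nr" unfolding basis_def by auto
  moreover have "span S \<subseteq> span (set (cols X))" by (rule span_is_monotone[OF Sc])
  ultimately have "v \<in> col_space X" using v by (auto simp: col_space_def)
  then obtain w where w: "w \<in> carrier_vec nc" "X *\<^sub>v w = v"
    using col_space_eq[of X] X by auto
  have "v \<bullet> v = (transpose_mat X *\<^sub>v v) \<bullet> w"
    using transpose_vec_mult_scalar[OF X w(1) v] w(2) by simp
  also have "\<dots> = 0" using Xv w by simp
  finally show ?thesis using real_scalar_prod_self_eq_0[OF v] by simp
qed

text \<open>The Gram matrix \<open>X X^T\<close> of the transpose is invertible, with inverse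
  \<open>H\<close> say, so every \<open>v\<close> has the explicit preimage \<open>X^T (H v)\<close>
  under \<open>X\<close> and the columns span the whole space.\<close>

lemma transpose_injective_full_row_rank:
  assumes X: "X \<in> carrier_mat nr nc"
    and inj: "\<And>v. v \<in> carrier_vec nr \<Longrightarrow> transpose_mat X *\<^sub>v v = 0\<^sub>v nc \<Longrightarrow> v = 0\<^sub>v nr"
  shows "full_row_rank X"
proof -
  interpret vec_space "TYPE(real)" nr .
  have XT: "transpose_mat X \<in> carrier_mat nc nr" using X by simp
  have G: "X * transpose_mat X \<in> carrier_mat nr nr" using X by simp
  obtain H where H: "H \<in> carrier_mat nr nr" "(X * transpose_mat X) * H = 1\<^sub>m nr"
    using injective_square_mat_inverse[OF G] gram_mult_vec_eq_0[OF XT] inj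
    by (metis Matrix.transpose_transpose)
  have "v \<in> col_space X" if v: "v \<in> carrier_vec nr" for v
  proof -
    have "X *\<^sub>v (transpose_mat X *\<^sub>v (H *\<^sub>v v)) = ((X * transpose_mat X) * H) *\<^sub>v v"
      by (simp only: assoc_mult_mat_vec[OF G H(1) v]
          assoc_mult_mat_vec[OF X XT mult_mat_vec_carrier[OF H(1) v]])
    also have "\<dots> = v" using H v by simp
    finally have "X *\<^sub>v (transpose_mat X *\<^sub>v (H *\<^sub>v v)) = v" .
    moreover have "transpose_mat X *\<^sub>v (H *\<^sub>v v) \<in> carrier_vec nc"
      by (rule mult_mat_vec_carrier[OF XT mult_mat_vec_carrier[OF H(1) v]])
    ultimately show ?thesis unfolding col_space_eq[OF X] using X v by blast
  qed
  moreover have "span (set (cols X)) \<subseteq> carrier_vec nr"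
    using X cols_dim[of X] by (intro span_is_subset2) auto
  ultimately have sp: "span (set (cols X)) = carrier_vec nr" by (auto simp: col_space_def)
  \<comment> \<open>The rank is the dimension of the span with the restricted structure; once the
    span is everything, this structure must be identified with the ambient space.\<close>
  have "vs (carrier_vec nr) = V" by (simp add: module_vec_def)
  then have "rank X = nr" unfolding rank_def sp by (simp only: dim_is_n)
  then show ?thesis using X unfolding full_row_rank_def mat_rank_def by simp
qed

subsection \<open>Pseudo-inverses\<close>

text \<open>Penrose's argument: symmetry of the products yields \<open>X P = X Q\<close> and
  \<open>P X = Q X\<close>, whence \<open>P = P X P = Q X P = Q X Q = Q\<close>.\<close>

lemma is_pseudo_inverse_unique:
  assumes X: "X \<in> carrier_mat nr nc" and P: "is_pseudo_inverse X P" and Q: "is_pseudo_inverse X Q"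
  shows "P = Q"
proof -
  note [simp] = X
  have PC[simp]: "P \<in> carrier_mat nc nr" and QC[simp]: "Q \<in> carrier_mat nc nr"
    using P Q X unfolding is_pseudo_inverse_def by auto
  have [simp]: "X * P \<in> carrier_mat nr nr" "X * Q \<in> carrier_mat nr nr"
    "P * X \<in> carrier_mat nc nc" "Q * X \<in> carrier_mat nc nc"
    by (fact mult_carrier_mat[OF X PC] mult_carrier_mat[OF X QC]
        mult_carrier_mat[OF PC X] mult_carrier_mat[OF QC X])+
  note p = P[unfolded is_pseudo_inverse_def, THEN conjunct2]
  note q = Q[unfolded is_pseudo_inverse_def, THEN conjunct2]
  have "X * P = transpose_mat (X * P)" using p by simp
  also have "\<dots> = transpose_mat ((X * Q * X) * P)" using q by simp
  \<comment> \<open>Transposing a product of two symmetric matrices swaps them, so that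
    \<open>X P X\<close> can be collapsed to \<open>X\<close> and \<open>P\<close>
    disappears.\<close>
  also have "(X * Q * X) * P = (X * Q) * (X * P)"
    by (rule assoc_mult_mat[of _ nr nr _ nc _ nr]) auto
  also have "transpose_mat \<dots> = transpose_mat (X * P) * transpose_mat (X * Q)"
    by (rule transpose_mult[of _ nr nr _ nr]) auto
  also have "\<dots> = (X * P) * (X * Q)" using p q by simp
  also have "\<dots> = (X * P * X) * Q"
    by (rule assoc_mult_mat[of _ nr nr _ nc _ nr, symmetric]) auto
  also have "\<dots> = X * Q" using p by simp
  finally have l: "X * P = X * Q" .
  have "P * X = transpose_mat (P * X)" using p by simp
  also have "\<dots> = transpose_mat (P * (X * Q * X))" using q by simp
  also have "P * (X * Q * X) = (P * X) * (Q * X)"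
    by (simp add: assoc_mult_mat[of _ nc nr _ nc _ nc] assoc_mult_mat[of _ nr nc _ nr _ nc])
  also have "transpose_mat \<dots> = transpose_mat (Q * X) * transpose_mat (P * X)"
    by (rule transpose_mult[of _ nc nc _ nc]) auto
  also have "\<dots> = (Q * X) * (P * X)" using p q by simp
  also have "\<dots> = Q * (X * P * X)"
    by (simp add: assoc_mult_mat[of _ nc nr _ nc _ nc] assoc_mult_mat[of _ nr nc _ nr _ nc])
  also have "\<dots> = Q * X" using p by simp
  finally have r: "P * X = Q * X" .
  have "P = P * X * P" using p by simp
  also have "\<dots> = Q * X * P" using r by simp
  also have "\<dots> = Q * (X * P)" by (rule assoc_mult_mat[of _ nc nr _ nc _ nr]) auto
  also have "\<dots> = Q * (X * Q)" using l by simp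
  also have "\<dots> = Q * X * Q" by (rule assoc_mult_mat[of _ nc nr _ nc _ nr, symmetric]) auto
  also have "\<dots> = Q" using q by simp
  finally show ?thesis .
qed

text \<open>With \<open>H\<close> the inverse of \<open>X^T X\<close>, the candidate
  \<open>H X^T\<close> is a left inverse satisfying the four Penrose conditions. Uniqueness then
  identifies it with the definite description.\<close>

lemma pseudo_inverse_injective:
  assumes X: "X \<in> carrier_mat nr nc"
    and inj: "\<And>v. v \<in> carrier_vec nc \<Longrightarrow> X *\<^sub>v v = 0\<^sub>v nr \<Longrightarrow> v = 0\<^sub>v nc"
  shows "pseudo_inverse X \<in> carrier_mat nc nr" and "pseudo_inverse X * X = 1\<^sub>m nc"
proof -
  let ?T = "transpose_mat X"
  let ?G = "?T * X"
  have T[simp]: "?T \<in> carrier_mat nc nr" and G[simp]: "?G \<in> carrier_mat nc nc"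
    and [simp]: "X \<in> carrier_mat nr nc" using X by auto
  obtain H where H[simp]: "H \<in> carrier_mat nc nc" and HG: "H * ?G = 1\<^sub>m nc" and GH: "?G * H = 1\<^sub>m nc"
    using injective_square_mat_inverse[OF G] gram_mult_vec_eq_0[OF X] inj by metis
  have GT: "transpose_mat ?G = ?G" by (simp add: transpose_mult[OF T X])
  \<comment> \<open>The transpose of \<open>H\<close> is also a left inverse of the symmetric Gram
    matrix, and a left inverse equals the right inverse \<open>H\<close>.\<close>
  have HT: "transpose_mat H = H"
  proof -
    have "transpose_mat H * ?G = transpose_mat (?G * H)"
      by (simp add: transpose_mult[OF G H] GT)
    then have *: "transpose_mat H * ?G = 1\<^sub>m nc" using GH by simp
    have "transpose_mat H = transpose_mat H * (?G * H)"
      unfolding GH by (rule right_mult_one_mat[of _ nc nc, symmetric]) simp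
    also have "\<dots> = (transpose_mat H * ?G) * H"
      by (rule assoc_mult_mat[of _ nc nc _ nc _ nc, symmetric]) auto
    also have "\<dots> = H" unfolding * by (rule left_mult_one_mat[OF H])
    finally show ?thesis .
  qed
  let ?P = "H * ?T"
  have P[simp]: "?P \<in> carrier_mat nc nr" by (rule mult_carrier_mat[OF H T])
  have PX: "?P * X = 1\<^sub>m nc" using HG by (simp add: assoc_mult_mat[OF H T X])
  have "transpose_mat (X * ?P) = X * ?P"
  proof -
    have "transpose_mat (X * ?P) = transpose_mat ?P * ?T" by (rule transpose_mult[OF X P])
    also have "transpose_mat ?P = X * H" by (simp add: transpose_mult[OF H T] HT)
    also have "X * H * ?T = X * ?P" by (rule assoc_mult_mat[OF X H T])
    finally show ?thesis .
  qed
  moreover have "X * ?P * X = X"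
    by (simp only: assoc_mult_mat[OF X P X] PX right_mult_one_mat[OF X])
  moreover have "?P * X * ?P = ?P"
    by (simp only: PX left_mult_one_mat[OF P])
  moreover have "?P \<in> carrier_mat (dim_col X) (dim_row X)"
    using P by (simp only: carrier_matD[OF X])
  moreover have "transpose_mat (?P * X) = ?P * X" unfolding PX by simp
  ultimately have "is_pseudo_inverse X ?P"
    unfolding is_pseudo_inverse_def by blast
  then have "pseudo_inverse X = ?P"
    unfolding pseudo_inverse_def using is_pseudo_inverse_unique[OF X] by blast
  then show "pseudo_inverse X \<in> carrier_mat nc nr" "pseudo_inverse X * X = 1\<^sub>m nc"
    using P PX by auto
qed

subsection \<open>Block matrices\<close>

lemma append_cols_mult_vec:
  assumes X: "X \<in> carrier_mat nr c1" and Y: "Y \<in> carrier_mat nr c2"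
    and a: "a \<in> carrier_vec c1" and b: "b \<in> carrier_vec c2"
  shows "append_cols X Y *\<^sub>v (a @\<^sub>v b) = X *\<^sub>v a + Y *\<^sub>v b"
proof -
  \<comment> \<open>The lower blocks have no rows, so the second component is a vector of dimension
    0.\<close>
  have "append_cols X Y *\<^sub>v (a @\<^sub>v b)
      = (X *\<^sub>v a + Y *\<^sub>v b) @\<^sub>v (0\<^sub>m 0 c1 *\<^sub>v a + 0\<^sub>m 0 c2 *\<^sub>v b)"
    using four_block_mat_mult_vec[OF X Y _ _ a b, of "0\<^sub>m 0 c1" 0 "0\<^sub>m 0 c2"] X Y
    unfolding append_cols_def by auto
  also have "\<dots> = X *\<^sub>v a + Y *\<^sub>v b"
    by (rule eq_vecI) auto
  finally show ?thesis .
qed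

lemma append_cols_carrier:
  assumes "X \<in> carrier_mat nr c1" "Y \<in> carrier_mat nr c2"
  shows "append_cols X Y \<in> carrier_mat nr (c1 + c2)"
  using assms unfolding append_cols_def by auto

text \<open>Transposition turns juxtaposed columns into stacked rows; this splits the equation
  \<open>v^T M = 0\<close> into one equation per block.\<close>

lemma transpose_append_cols_mult_vec:
  assumes X: "X \<in> carrier_mat nr c1" and Y: "Y \<in> carrier_mat nr c2" and v: "v \<in> carrier_vec nr"
  shows "transpose_mat (append_cols X Y) *\<^sub>v v
    = (transpose_mat X *\<^sub>v v) @\<^sub>v (transpose_mat Y *\<^sub>v v)"
proof -
  have "transpose_mat (append_cols X Y) = transpose_mat X @\<^sub>r transpose_mat Y"
    using X Y unfolding append_cols_def append_rows_def
    by (intro eq_matI) auto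
  then show ?thesis
    using mat_mult_append[of "transpose_mat X" c1 nr "transpose_mat Y" c2 v] X Y v by simp
qed

text \<open>Row \<open>i\<close> of \<open>X\<close> is cut into \<open>N\<close> pieces of width
  \<open>d\<close>, piece \<open>k\<close> being row \<open>i'\<close> of the block
  \<open>F k\<close>. The two row indices are separate because in the Toeplitz matrix row
  \<open>i\<close> is row \<open>i mod p\<close> of its blocks, while in the reachability matrix
  they agree.\<close>

lemma block_row_mult_window:
  assumes X: "X \<in> carrier_mat r (d * N)" and i: "i < r" and i': "i' < r'"
    and F: "\<And>k. k < N \<Longrightarrow> F k \<in> carrier_mat r' d"
    and w: "\<And>s. w s \<in> carrier_vec d"
    and entries: "\<And>k l. k < N \<Longrightarrow> l < d \<Longrightarrow> X $$ (i, k * d + l) = F k $$ (i', l)"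
  shows "(X *\<^sub>v window d N w t) $ i = (\<Sum>k<N. (F k *\<^sub>v w (t - N + k)) $ i')"
proof -
  let ?f = "\<lambda>j. X $$ (i, j) * w (t - N + j div d) $ (j mod d)"
  have "(X *\<^sub>v window d N w t) $ i = (\<Sum>j<N * d. ?f j)"
    using X i unfolding window_def
    by (auto simp: scalar_prod_def atLeast0LessThan mult.commute intro!: sum.cong)
  also have "\<dots> = (\<Sum>k<N. \<Sum>j\<in>{k * d..<k * d + d}. ?f j)"
    by (rule sum.nat_group[symmetric])
  also have "\<dots> = (\<Sum>k<N. (F k *\<^sub>v w (t - N + k)) $ i')"
  proof (rule sum.cong[OF refl])
    fix k assume "k \<in> {..<N}"
    then have k: "k < N" by simp
    have "(\<Sum>j\<in>{k * d..<k * d + d}. ?f j) = (\<Sum>l = 0..<d. ?f (k * d + l))"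
      using sum.shift_bounds_nat_ivl[of ?f 0 "k * d" d] by (simp add: ac_simps)
    also have "\<dots> = (\<Sum>l = 0..<d. F k $$ (i', l) * w (t - N + k) $ l)"
      using entries[OF k] by (intro sum.cong) auto
    also have "\<dots> = (F k *\<^sub>v w (t - N + k)) $ i'"
      using F[OF k] w[of "t - N + k"] i' by (simp add: scalar_prod_def)
    finally show "(\<Sum>j\<in>{k * d..<k * d + d}. ?f j) = (F k *\<^sub>v w (t - N + k)) $ i'" .
  qed
  finally show ?thesis .
qed

lemma block_index_less: "k < N \<Longrightarrow> l < d \<Longrightarrow> k * d + l < d * (N::nat)"
proof -
  assume "k < N" "l < d"
  then have "k * d + l < Suc k * d" by simp
  also have "\<dots> \<le> N * d" using \<open>k < N\<close> by (intro mult_le_mono1) simp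
  finally show ?thesis by (simp add: mult.commute)
qed

lemma block_index_bounds:
  assumes "j < d * (N::nat)"
  shows "j div d < N" and "j mod d < d"
proof -
  show "j div d < N" using assms by (simp add: less_mult_imp_div_less mult.commute)
  \<comment> \<open>The existence of an index excludes blocks of width 0, for which
    \<open>mod\<close> would give no bound.\<close>
  have "0 < d" using assms by (cases d) auto
  then show "j mod d < d" by simp
qed

lemma window_carrier: "window d N w t \<in> carrier_vec (d * N)"
  by (simp add: window_def)

section \<open>Matrix powers and products with vectors\<close>

text \<open>The library recursion puts the new factor on the right; unrolling a trajectory from the
  front needs it on the left.\<close>

lemma pow_mat_Suc_left:
  assumes A: "(A :: 'a :: semiring_1 mat) \<in> carrier_mat n n"
  shows "A ^\<^sub>m Suc k = A * A ^\<^sub>m k"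
proof (induction k)
  case 0
  then show ?case using A by simp
next
  case (Suc k)
  have "A ^\<^sub>m Suc (Suc k) = A * A ^\<^sub>m k * A" using Suc by simp
  also have "\<dots> = A * A ^\<^sub>m Suc k" by (simp add: assoc_mult_mat[OF A pow_carrier_mat[OF A] A])
  finally show ?case .
qed

lemma pow_mat_add:
  assumes A: "(A :: 'a :: semiring_1 mat) \<in> carrier_mat n n"
  shows "A ^\<^sub>m (k + l) = A ^\<^sub>m k * A ^\<^sub>m l"
proof (induction l)
  case 0
  then show ?case using A by simp
next
  case (Suc l)
  then show ?case by (simp add: assoc_mult_mat[OF pow_carrier_mat[OF A] pow_carrier_mat[OF A] A])
qed

lemma mat_mult_zero_vec:
  fixes X :: "'a :: semiring_0 mat"
  assumes "X \<in> carrier_mat nr nc"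
  shows "X *\<^sub>v 0\<^sub>v nc = 0\<^sub>v nr"
  using assms by (intro eq_vecI) auto

lemma transpose_mult_vec:
  fixes X Y :: "'a :: comm_semiring_0 mat"
  assumes "X \<in> carrier_mat a b" "Y \<in> carrier_mat b c" "v \<in> carrier_vec a"
  shows "transpose_mat (X * Y) *\<^sub>v v = transpose_mat Y *\<^sub>v (transpose_mat X *\<^sub>v v)"
  using assms by (simp add: transpose_mult[OF assms(1,2)])

subsection \<open>Trajectories of linear systems\<close>

locale lti_system =
  fixes A B C :: "real mat" and n m p :: nat
  assumes A: "A \<in> carrier_mat n n" and B: "B \<in> carrier_mat n m" and C: "C \<in> carrier_mat p n"
begin

lemma reach_mat_carrier: "reach_mat N A B \<in> carrier_mat n (m * N)"
  using A B unfolding reach_mat_def by auto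

lemma obs_mat_carrier: "obs_mat N A C \<in> carrier_mat (p * N) n"
  using A C unfolding obs_mat_def by auto

lemma toeplitz_mat_carrier: "toeplitz_mat N A B C \<in> carrier_mat (p * N) (m * N)"
  using B C unfolding toeplitz_mat_def by auto

lemma pow_mult_B_carrier: "A ^\<^sub>m k * B \<in> carrier_mat n m"
  using A B by (meson mult_carrier_mat pow_carrier_mat)

lemma C_mult_pow_carrier: "C * A ^\<^sub>m k \<in> carrier_mat p n"
  using A C by (meson mult_carrier_mat pow_carrier_mat)

section \<open>Kernels of the observability and reachability matrices\<close>

lemma obs_mat_mult_vec_index:
  assumes x: "x \<in> carrier_vec n" and i: "i < p * N"
  shows "(obs_mat N A C *\<^sub>v x) $ i = ((C * A ^\<^sub>m (i div p)) *\<^sub>v x) $ (i mod p)"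
proof -
  define D where "D = C * A ^\<^sub>m (i div p)"
  have D: "D \<in> carrier_mat p n" unfolding D_def by (rule C_mult_pow_carrier)
  have im: "i mod p < p" using block_index_bounds[OF i] by simp
  have "obs_mat N A C $$ (i, j) = D $$ (i mod p, j)" if "j < n" for j
    using A C i that by (simp add: obs_mat_def D_def)
  then have "row (obs_mat N A C) i = row D (i mod p)"
    using obs_mat_carrier[of N] D i im by (intro eq_vecI) auto
  then show ?thesis using obs_mat_carrier[of N] D i im unfolding D_def[symmetric] by simp
qed

text \<open>Written blockwise, the kernel visibly shrinks as \<open>N\<close> grows, so injectivity
  passes from the observability index to every longer window.\<close>

lemma obs_mat_kernel_iff:
  assumes x: "x \<in> carrier_vec n"
  shows "obs_mat N A C *\<^sub>v x = 0\<^sub>v (p * N) \<longleftrightarrow> (\<forall>k<N. (C * A ^\<^sub>m k) *\<^sub>v x = 0\<^sub>v p)"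
proof
  assume 0: "obs_mat N A C *\<^sub>v x = 0\<^sub>v (p * N)"
  show "\<forall>k<N. (C * A ^\<^sub>m k) *\<^sub>v x = 0\<^sub>v p"
  proof (intro allI impI eq_vecI)
    fix k l assume k: "k < N" and "l < dim_vec (0\<^sub>v p :: real vec)"
    then have l: "l < p" by simp
    then show "((C * A ^\<^sub>m k) *\<^sub>v x) $ l = 0\<^sub>v p $ l"
      using obs_mat_mult_vec_index[OF x block_index_less[OF k l]] 0 block_index_less[OF k l] by simp
  qed (use C in auto)
next
  assume 0: "\<forall>k<N. (C * A ^\<^sub>m k) *\<^sub>v x = 0\<^sub>v p"
  show "obs_mat N A C *\<^sub>v x = 0\<^sub>v (p * N)"
  proof (rule eq_vecI)
    fix i assume "i < dim_vec (0\<^sub>v (p * N) :: real vec)"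
    then have i: "i < p * N" by simp
    then show "(obs_mat N A C *\<^sub>v x) $ i = 0\<^sub>v (p * N) $ i"
      using obs_mat_mult_vec_index[OF x i] 0 block_index_bounds[OF i] by simp
  qed (use obs_mat_carrier in auto)
qed

lemma transpose_reach_mat_mult_vec_index:
  assumes v: "v \<in> carrier_vec n" and j: "j < m * N"
  shows "(transpose_mat (reach_mat N A B) *\<^sub>v v) $ j
    = (transpose_mat (A ^\<^sub>m (N - 1 - j div m) * B) *\<^sub>v v) $ (j mod m)"
proof -
  define D where "D = A ^\<^sub>m (N - 1 - j div m) * B"
  have D: "D \<in> carrier_mat n m" unfolding D_def by (rule pow_mult_B_carrier)
  have jm: "j mod m < m" using block_index_bounds[OF j] by simp
  have "reach_mat N A B $$ (i, j) = D $$ (i, j mod m)" if "i < n" for i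
    using A B j that by (simp add: reach_mat_def D_def)
  then have "col (reach_mat N A B) j = col D (j mod m)"
    using reach_mat_carrier[of N] D j jm by (intro eq_vecI) auto
  then show ?thesis using reach_mat_carrier[of N] D j jm unfolding D_def[symmetric] by simp
qed

lemma transpose_reach_mat_kernel_iff:
  assumes v: "v \<in> carrier_vec n"
  shows "transpose_mat (reach_mat N A B) *\<^sub>v v = 0\<^sub>v (m * N)
    \<longleftrightarrow> (\<forall>k<N. transpose_mat (A ^\<^sub>m k * B) *\<^sub>v v = 0\<^sub>v m)"
proof
  assume 0: "transpose_mat (reach_mat N A B) *\<^sub>v v = 0\<^sub>v (m * N)"
  show "\<forall>k<N. transpose_mat (A ^\<^sub>m k * B) *\<^sub>v v = 0\<^sub>v m"
  proof (intro allI impI eq_vecI)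
    fix k l assume k: "k < N" and "l < dim_vec (0\<^sub>v m :: real vec)"
    \<comment> \<open>The blocks are stored in reverse order: \<open>A^k B\<close> sits in column
      block \<open>N - 1 - k\<close>.\<close>
    then have l: "l < m" and k': "N - 1 - k < N" by auto
    then show "(transpose_mat (A ^\<^sub>m k * B) *\<^sub>v v) $ l = 0\<^sub>v m $ l"
      using transpose_reach_mat_mult_vec_index[OF v block_index_less[OF k' l]] 0 k
        block_index_less[OF k' l] by simp
  qed (use B in auto)
next
  assume 0: "\<forall>k<N. transpose_mat (A ^\<^sub>m k * B) *\<^sub>v v = 0\<^sub>v m"
  show "transpose_mat (reach_mat N A B) *\<^sub>v v = 0\<^sub>v (m * N)"
  proof (rule eq_vecI)
    fix j assume "j < dim_vec (0\<^sub>v (m * N) :: real vec)"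
    then have j: "j < m * N" by simp
    then have "N - 1 - j div m < N" using block_index_bounds[OF j] by simp
    then show "(transpose_mat (reach_mat N A B) *\<^sub>v v) $ j = 0\<^sub>v (m * N) $ j"
      using transpose_reach_mat_mult_vec_index[OF v j] 0 block_index_bounds[OF j] j by simp
  qed (use reach_mat_carrier in auto)
qed

section \<open>States and outputs over a window\<close>

lemma pow_carrier: "A ^\<^sub>m k \<in> carrier_mat n n"
  using A by simp

text \<open>The left factor \<open>D\<close> is needed to run the induction from the front; \<open>D = 1\<close> gives the state
  and \<open>D = C\<close> the output.\<close>

lemma trajectory_unroll:
  assumes tr: "trajectory A B C u x y" and D: "D \<in> carrier_mat r n" and i: "i < r"
  shows "(D *\<^sub>v x (s + k)) $ i = ((D * A ^\<^sub>m k) *\<^sub>v x s) $ i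
    + (\<Sum>l<k. ((D * A ^\<^sub>m (k - l - 1) * B) *\<^sub>v u (s + l)) $ i)"
  using D
proof (induction k arbitrary: D)
  case 0
  then show ?case using A i by simp
next
  case (Suc k)
  note D = Suc.prems
  have x: "x t \<in> carrier_vec n" and u: "u t \<in> carrier_vec m"
    and step: "x (Suc t) = A *\<^sub>v x t + B *\<^sub>v u t" for t
    using tr A B unfolding trajectory_def by auto
  have DA: "D * A \<in> carrier_mat r n" using D A by auto
  have pw: "D * A * A ^\<^sub>m j = D * A ^\<^sub>m Suc j" for j
    unfolding pow_mat_Suc_left[OF A] by (rule assoc_mult_mat[OF D A pow_carrier])
  \<comment> \<open>Only the last transition is opened; its factor \<open>A\<close> is absorbed on
    the left, and the induction hypothesis is applied with \<open>D * A\<close> in place of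
    \<open>D\<close>.\<close>
  have "D *\<^sub>v x (s + Suc k) = (D * A) *\<^sub>v x (s + k) + (D * B) *\<^sub>v u (s + k)"
    using step[of "s + k"] mult_add_distrib_mat_vec[OF D, of "A *\<^sub>v x (s + k)" "B *\<^sub>v u (s + k)"]
      A B x[of "s + k"] u[of "s + k"] assoc_mult_mat_vec[OF D A x] assoc_mult_mat_vec[OF D B u]
    by simp
  then have "(D *\<^sub>v x (s + Suc k)) $ i = ((D * A) *\<^sub>v x (s + k)) $ i + ((D * B) *\<^sub>v u (s + k)) $ i"
    using D B i by simp
  also have "((D * A) *\<^sub>v x (s + k)) $ i = ((D * A ^\<^sub>m Suc k) *\<^sub>v x s) $ i
      + (\<Sum>l<k. ((D * A ^\<^sub>m Suc (k - l - 1) * B) *\<^sub>v u (s + l)) $ i)"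
    unfolding Suc.IH[OF DA] pw ..
  also have "(\<Sum>l<k. ((D * A ^\<^sub>m Suc (k - l - 1) * B) *\<^sub>v u (s + l)) $ i)
      = (\<Sum>l<k. ((D * A ^\<^sub>m (Suc k - l - 1) * B) *\<^sub>v u (s + l)) $ i)"
  proof (rule sum.cong[OF refl])
    fix l assume "l \<in> {..<k}"
    then have "Suc (k - l - 1) = Suc k - l - 1" by auto
    then show "((D * A ^\<^sub>m Suc (k - l - 1) * B) *\<^sub>v u (s + l)) $ i
      = ((D * A ^\<^sub>m (Suc k - l - 1) * B) *\<^sub>v u (s + l)) $ i" by (simp only:)
  qed
  \<comment> \<open>The input at time \<open>s + k\<close> has exponent 0 and becomes the summand
    \<open>l = k\<close> of the extended sum.\<close>
  also have "D * B = D * A ^\<^sub>m (Suc k - k - 1) * B" using A D by simp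
  finally show ?case by (simp add: algebra_simps)
qed

text \<open>This is the unrolled recursion with \<open>D = 1\<close> over \<open>N\<close> steps
  from \<open>t - N\<close>. The latest input \<open>u (t - 1)\<close> meets the last block
  \<open>B\<close>; the bound on \<open>t\<close> makes \<open>t - N + N\<close> equal to
  \<open>t\<close>.\<close>

lemma trajectory_state_window:
  assumes tr: "trajectory A B C u x y" and t: "N \<le> t"
  shows "x t = A ^\<^sub>m N *\<^sub>v x (t - N) + reach_mat N A B *\<^sub>v window m N u t"
proof (rule eq_vecI)
  have x: "x t \<in> carrier_vec n" and u: "u t \<in> carrier_vec m" for t
    using tr A B unfolding trajectory_def by auto
  note R = reach_mat_carrier[of N]
  show "dim_vec (x t) = dim_vec (A ^\<^sub>m N *\<^sub>v x (t - N) + reach_mat N A B *\<^sub>v window m N u t)"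
    using x[of t] R by simp
  fix i assume "i < dim_vec (A ^\<^sub>m N *\<^sub>v x (t - N) + reach_mat N A B *\<^sub>v window m N u t)"
  then have i: "i < n" using R by simp
  have one: "1\<^sub>m n * A ^\<^sub>m k = A ^\<^sub>m k" for k by (rule left_mult_one_mat[OF pow_carrier])
  have "(reach_mat N A B *\<^sub>v window m N u t) $ i
      = (\<Sum>l<N. ((A ^\<^sub>m (N - l - 1) * B) *\<^sub>v u (t - N + l)) $ i)"
  proof (rule block_row_mult_window[OF R i i pow_mult_B_carrier u])
    fix k l assume kl: "k < N" "l < m"
    then show "reach_mat N A B $$ (i, k * m + l) = (A ^\<^sub>m (N - k - 1) * B) $$ (i, l)"
      using A B i block_index_less[OF kl] unfolding reach_mat_def by simp
  qed
  moreover have "x t $ i = (A ^\<^sub>m N *\<^sub>v x (t - N)) $ i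
      + (\<Sum>l<N. ((A ^\<^sub>m (N - l - 1) * B) *\<^sub>v u (t - N + l)) $ i)"
    using trajectory_unroll[OF tr one_carrier_mat i, of "t - N" N] t x[of t] unfolding one by simp
  ultimately show "x t $ i = (A ^\<^sub>m N *\<^sub>v x (t - N) + reach_mat N A B *\<^sub>v window m N u t) $ i"
    using R i by simp
qed

text \<open>Output block \<open>k\<close> is the recursion with \<open>D = C\<close> unrolled
  \<open>k\<close> steps from \<open>t - N\<close>. Both windows start at this same, possibly
  truncated, time, so the identity holds for every \<open>t\<close>.\<close>

lemma trajectory_output_window:
  assumes tr: "trajectory A B C u x y"
  shows "window p N y t = obs_mat N A C *\<^sub>v x (t - N) + toeplitz_mat N A B C *\<^sub>v window m N u t"
proof (rule eq_vecI)
  have x: "x t \<in> carrier_vec n" and u: "u t \<in> carrier_vec m" and y: "y t = C *\<^sub>v x t" for t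
    using tr A B unfolding trajectory_def by auto
  note O = obs_mat_carrier[of N] and T = toeplitz_mat_carrier[of N]
  show "dim_vec (window p N y t)
    = dim_vec (obs_mat N A C *\<^sub>v x (t - N) + toeplitz_mat N A B C *\<^sub>v window m N u t)"
    using T by (simp add: window_def)
  fix i assume "i < dim_vec (obs_mat N A C *\<^sub>v x (t - N) + toeplitz_mat N A B C *\<^sub>v window m N u t)"
  then have i: "i < p * N" using T by simp
  define k where "k = i div p"
  have k: "k < N" and im: "i mod p < p" using block_index_bounds[OF i] by (auto simp: k_def)
  \<comment> \<open>These are the blocks in block row \<open>k\<close> of the Toeplitz matrix. The
    zero blocks express causality: output \<open>k\<close> depends only on inputs before it.\<close>
  let ?F = "\<lambda>l. if l < k then C * A ^\<^sub>m (k - l - 1) * B else 0\<^sub>m p m"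
  have F: "C * A ^\<^sub>m j * B \<in> carrier_mat p m" for j
    using mult_carrier_mat[OF C_mult_pow_carrier B] .
  have "(toeplitz_mat N A B C *\<^sub>v window m N u t) $ i = (\<Sum>l<N. (?F l *\<^sub>v u (t - N + l)) $ (i mod p))"
  proof (rule block_row_mult_window[OF T i im _ u])
    show "?F l \<in> carrier_mat p m" for l using F by simp
    fix l j assume lj: "l < N" "j < m"
    then show "toeplitz_mat N A B C $$ (i, l * m + j) = ?F l $$ (i mod p, j)"
      using B C i im block_index_less[OF lj] unfolding toeplitz_mat_def by (simp add: k_def)
  qed
  also have "\<dots> = (\<Sum>l<k. (?F l *\<^sub>v u (t - N + l)) $ (i mod p))"
    using k im u by (intro sum.mono_neutral_right) auto
  also have "\<dots> = (\<Sum>l<k. ((C * A ^\<^sub>m (k - l - 1) * B) *\<^sub>v u (t - N + l)) $ (i mod p))"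
    by (intro sum.cong) auto
  finally have "(toeplitz_mat N A B C *\<^sub>v window m N u t) $ i = \<dots>" .
  moreover have "(obs_mat N A C *\<^sub>v x (t - N)) $ i = ((C * A ^\<^sub>m k) *\<^sub>v x (t - N)) $ (i mod p)"
    unfolding k_def by (rule obs_mat_mult_vec_index[OF x i])
  moreover have "window p N y t $ i = (C *\<^sub>v x (t - N + k)) $ (i mod p)"
    using i by (simp add: window_def y k_def)
  ultimately show "window p N y t $ i
    = (obs_mat N A C *\<^sub>v x (t - N) + toeplitz_mat N A B C *\<^sub>v window m N u t) $ i"
    using trajectory_unroll[OF tr C im, of "t - N" k] T i by simp
qed

section \<open>Consequences of observability and controllability\<close>

lemma observable_obs_mat_injective:
  assumes obs: "observable A C" and N: "obs_index A C \<le> N"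
    and x: "x \<in> carrier_vec n" and 0: "obs_mat N A C *\<^sub>v x = 0\<^sub>v (p * N)"
  shows "x = 0\<^sub>v n"
proof (cases "n = 0")
  case True
  then show ?thesis using x by auto
next
  case False
  let ?P = "\<lambda>N. 0 < N \<and> mat_rank (obs_mat N A C) = dim_row A"
  \<comment> \<open>Observability makes \<open>n\<close> a witness for the least element only when
    \<open>n\<close> is positive, hence the separate case of dimension 0.\<close>
  have "?P n" using obs False A unfolding observable_def by auto
  then have "?P (obs_index A C)" unfolding obs_index_def by (rule LeastI)
  then have r: "mat_rank (obs_mat (obs_index A C) A C) = n" using A by simp
  have "obs_mat (obs_index A C) A C *\<^sub>v x = 0\<^sub>v (p * obs_index A C)"
    using 0 N unfolding obs_mat_kernel_iff[OF x] by auto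
  then show ?thesis by (rule full_col_rank_injective[OF obs_mat_carrier r x])
qed

text \<open>Controllability is stated with horizon \<open>n\<close>, which may exceed
  \<open>N\<close>. The powers from \<open>N\<close> on factor through \<open>A^N\<close>, which
  \<open>v^T\<close> annihilates, so all \<open>v^T A^k B\<close> vanish whatever the order of
  \<open>n\<close> and \<open>N\<close>.\<close>

lemma controllable_transpose_kernel:
  assumes ctr: "controllable A B" and v: "v \<in> carrier_vec n"
    and R: "transpose_mat (reach_mat N A B) *\<^sub>v v = 0\<^sub>v (m * N)"
    and AN: "transpose_mat (A ^\<^sub>m N) *\<^sub>v v = 0\<^sub>v n"
  shows "v = 0\<^sub>v n"
proof -
  have "transpose_mat (A ^\<^sub>m k * B) *\<^sub>v v = 0\<^sub>v m" for k
  proof (cases "k < N")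
    case True
    then show ?thesis using R unfolding transpose_reach_mat_kernel_iff[OF v] by simp
  next
    case False
    define D where "D = A ^\<^sub>m (k - N) * B"
    have D: "D \<in> carrier_mat n m" unfolding D_def by (rule pow_mult_B_carrier)
    have "A ^\<^sub>m k * B = A ^\<^sub>m N * D"
      using False pow_mat_add[OF A, of N "k - N"] assoc_mult_mat[OF pow_carrier pow_carrier B]
      by (simp add: D_def)
    then have "transpose_mat (A ^\<^sub>m k * B) *\<^sub>v v = transpose_mat D *\<^sub>v 0\<^sub>v n"
      by (simp only: transpose_mult_vec[OF pow_carrier D v] AN)
    also have "\<dots> = 0\<^sub>v m" using D by (intro mat_mult_zero_vec) simp
    finally show ?thesis .
  qed
  then have "transpose_mat (reach_mat n A B) *\<^sub>v v = 0\<^sub>v (m * n)"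
    unfolding transpose_reach_mat_kernel_iff[OF v] by simp
  moreover have "mat_rank (reach_mat n A B) = n" using ctr A unfolding controllable_def by simp
  ultimately show ?thesis
    using full_row_rank_transpose_injective[OF reach_mat_carrier _ v] by blast
qed

end

section \<open>The state formula and the rank of the state map\<close>

theorem theorem3p2:
  fixes A B C Q :: "real mat" and n m p N :: nat
  assumes "A \<in> carrier_mat n n" and "B \<in> carrier_mat n m" and "C \<in> carrier_mat p n"
    and "Q \<in> carrier_mat p p"
    and "p \<le> n" and "full_row_rank C" and "pos_semidef Q"
    and "controllable A B"
    and "observable A C"
    and "observable A (psd_sqrt (transpose_mat C * Q * C))"
    and "obs_index A C \<le> N"
  shows "(\<forall>u x y t. trajectory A B C u x y \<longrightarrow> N \<le> t \<longrightarrow>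
            x t = state_map N A B C *\<^sub>v io_history m p N u y t)
       \<and> state_map N A B C \<in> carrier_mat n ((m + p) * N)
       \<and> full_row_rank (state_map N A B C)"
proof -
  interpret lti_system A B C n m p by unfold_locales (use assms in auto)
  let ?O = "obs_mat N A C" and ?R = "reach_mat N A B" and ?T = "toeplitz_mat N A B C"
  let ?P = "pseudo_inverse ?O"
  define Y where "Y = A ^\<^sub>m N * ?P"
  note O = obs_mat_carrier[of N] and R = reach_mat_carrier[of N]
    and T = toeplitz_mat_carrier[of N] and AN = pow_carrier[of N]
  have P: "?P \<in> carrier_mat n (p * N)" "?P * ?O = 1\<^sub>m n"
    using pseudo_inverse_injective[OF O] observable_obs_mat_injective[OF assms(9,11)] by auto
  have Y: "Y \<in> carrier_mat n (p * N)" unfolding Y_def by (rule mult_carrier_mat[OF AN P(1)])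
  \<comment> \<open>This cancellation serves both claims: it recovers the initial state's
    contribution in the formula, and it gives \<open>v^T A^N = 0\<close> from
    \<open>v^T Y = 0\<close> in the rank argument.\<close>
  have YO: "Y * ?O = A ^\<^sub>m N"
    unfolding Y_def assoc_mult_mat[OF AN P(1) O] P(2) by (rule right_mult_one_mat[OF AN])
  have YT: "Y * ?T \<in> carrier_mat n (m * N)" by (rule mult_carrier_mat[OF Y T])
  have RYT: "?R - Y * ?T \<in> carrier_mat n (m * N)" using YT by (rule minus_carrier_mat)
  have M: "state_map N A B C = append_cols (?R - Y * ?T) Y"
    unfolding state_map_def Y_def ..
  have Mc: "state_map N A B C \<in> carrier_mat n (m * N + p * N)"
    unfolding M by (rule append_cols_carrier[OF RYT Y])
  have "x t = state_map N A B C *\<^sub>v io_history m p N u y t"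
    if tr: "trajectory A B C u x y" and t: "N \<le> t" for u x y t
  proof -
    let ?u = "window m N u t" and ?x = "x (t - N)"
    have x: "?x \<in> carrier_vec n" using tr A unfolding trajectory_def by auto
    have u: "?u \<in> carrier_vec (m * N)" by (rule window_carrier)
    note Ox = mult_mat_vec_carrier[OF O x] and Tu = mult_mat_vec_carrier[OF T u]
      and Ru = mult_mat_vec_carrier[OF R u] and Ax = mult_mat_vec_carrier[OF AN x]
    \<comment> \<open>Here \<open>b\<close> will be the input contribution to the past outputs,
      \<open>Y (T u)\<close>, which the first block of the state map subtracts.\<close>
    have cancel: "a - b + (c + b) = c + a"
      if "a \<in> carrier_vec n" "b \<in> carrier_vec n" "c \<in> carrier_vec n" for a b c :: "real vec"
      using that by (intro eq_vecI) auto
    note YTu = mult_mat_vec_carrier[OF Y Tu]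
    have "state_map N A B C *\<^sub>v io_history m p N u y t
        = (?R - Y * ?T) *\<^sub>v ?u + Y *\<^sub>v (?O *\<^sub>v ?x + ?T *\<^sub>v ?u)"
      using append_cols_mult_vec[OF RYT Y u window_carrier[of p N y t]]
      unfolding M io_history_def trajectory_output_window[OF tr] .
    also have "(?R - Y * ?T) *\<^sub>v ?u = ?R *\<^sub>v ?u - Y *\<^sub>v (?T *\<^sub>v ?u)"
      unfolding minus_mult_distrib_mat_vec[OF R YT u] assoc_mult_mat_vec[OF Y T u] ..
    also have "Y *\<^sub>v (?O *\<^sub>v ?x + ?T *\<^sub>v ?u) = A ^\<^sub>m N *\<^sub>v ?x + Y *\<^sub>v (?T *\<^sub>v ?u)"
      unfolding mult_add_distrib_mat_vec[OF Y Ox Tu] assoc_mult_mat_vec[OF Y O x, symmetric] YO ..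
    also have "?R *\<^sub>v ?u - Y *\<^sub>v (?T *\<^sub>v ?u) + (A ^\<^sub>m N *\<^sub>v ?x + Y *\<^sub>v (?T *\<^sub>v ?u))
        = A ^\<^sub>m N *\<^sub>v ?x + ?R *\<^sub>v ?u"
      by (rule cancel[OF Ru YTu Ax])
    also have "\<dots> = x t" by (rule trajectory_state_window[OF tr t, symmetric])
    finally show ?thesis ..
  qed
  moreover have "full_row_rank (state_map N A B C)"
  proof (rule transpose_injective_full_row_rank[OF Mc])
    fix v :: "real vec"
    assume v: "v \<in> carrier_vec n"
      and 0: "transpose_mat (state_map N A B C) *\<^sub>v v = 0\<^sub>v (m * N + p * N)"
    have "(transpose_mat (?R - Y * ?T) *\<^sub>v v) @\<^sub>v (transpose_mat Y *\<^sub>v v) = 0\<^sub>v (m * N) @\<^sub>v 0\<^sub>v (p * N)"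
      unfolding transpose_append_cols_mult_vec[OF RYT Y v, symmetric] M[symmetric] 0
      by (intro eq_vecI) auto
    \<comment> \<open>Equal concatenations can be split only when the first parts have the same
      dimension.\<close>
    moreover have "transpose_mat (?R - Y * ?T) *\<^sub>v v \<in> carrier_vec (m * N)"
      using RYT v by (intro mult_mat_vec_carrier[of _ _ n]) auto
    ultimately have 1: "transpose_mat (?R - Y * ?T) *\<^sub>v v = 0\<^sub>v (m * N)"
      and 2: "transpose_mat Y *\<^sub>v v = 0\<^sub>v (p * N)"
      using append_vec_eq[OF _ zero_carrier_vec] by auto
    have "transpose_mat (A ^\<^sub>m N) *\<^sub>v v = transpose_mat ?O *\<^sub>v (transpose_mat Y *\<^sub>v v)"
      unfolding YO[symmetric] by (rule transpose_mult_vec[OF Y O v])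
    also have "\<dots> = 0\<^sub>v n" unfolding 2 using O by (intro mat_mult_zero_vec) simp
    finally have ANv: "transpose_mat (A ^\<^sub>m N) *\<^sub>v v = 0\<^sub>v n" .
    have "transpose_mat (Y * ?T) *\<^sub>v v = 0\<^sub>v (m * N)"
      unfolding transpose_mult_vec[OF Y T v] 2 using T by (intro mat_mult_zero_vec) simp
    then have "transpose_mat ?R *\<^sub>v v - 0\<^sub>v (m * N) = 0\<^sub>v (m * N)"
      using 1 R YT v unfolding transpose_minus[OF R YT]
      by (subst (asm) minus_mult_distrib_mat_vec[of _ "m * N" n]) auto
    moreover have "transpose_mat ?R *\<^sub>v v - 0\<^sub>v (m * N) = transpose_mat ?R *\<^sub>v v"
      using R by (intro eq_vecI) auto
    ultimately have "transpose_mat ?R *\<^sub>v v = 0\<^sub>v (m * N)" by simp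
    then show "v = 0\<^sub>v n" by (rule controllable_transpose_kernel[OF assms(8) v _ ANv])
  qed
  ultimately show ?thesis using Mc by (simp add: add_mult_distrib)
qed

end
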